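(* Let $(\mathcal{O},\preceq)$ be a totally ordered set for which there exist a probability space $(\Omega,\mathcal{F},\mathbf{P})$ and an increasing $\mathcal{O}$-family of $\mathcal{F}$-sets $(A_t)_{t\in\mathcal{O}}$ with $\bigcup_{t\in\mathcal{O}}A_t\in\mathcal{F}$ and $$\mathbf{P}\left(\bigcup_{t\in\mathcal{O}} A_t\right) > \sup_{t\in\mathcal{O}}\mathbf{P}(A_t) = 0.$$ Let $(m_t)_{t\in\mathcal{O}}$ be a non-decreasing family of non-negative real numbers (that is, $m_s\le m_t$ whenever $s\preceq t$), and let $M$ be a real number with $M\ge\sup_{t\in\mathcal{O}} m_t$. Then there exist a measure space $(E,\mathcal{E},\mu)$ and an increasing $\mathcal{O}$-family of $\mathcal{E}$-sets $(B_t)_{t\in\mathcal{O}}$ (with $\bigcup_{t\in\mathcal{O}}B_t\in\mathcal{E}$) such that $$\mu(B_t)=m_t \text{ for all } t\in\mathcal{O},\quad\text{and}\quad \mu\left(\bigcup_{t\in\mathcal{O}} B_t\right)=M.$$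
   Context: Given a measure space $(S,\mathcal{G},\nu)$ and a totally ordered index set $(\mathcal{O},\preceq)$, an increasing $\mathcal{O}$-family of $\mathcal{G}$-sets is a collection $(A_t)_{t\in\mathcal{O}}$ of $\mathcal{G}$-measurable sets such that $A_s\subseteq A_t$ whenever $s\preceq t$. *)

theory Defs
  imports "HOL-Probability.Probability"
begin

definition increasing_family ::
  "'o set \<Rightarrow> ('o \<times> 'o) set \<Rightarrow> 'a measure \<Rightarrow> ('o \<Rightarrow> 'a set) \<Rightarrow> bool" where
  "increasing_family T r N A \<longleftrightarrow>
     (\<forall>t\<in>T. A t \<in> sets N) \<and> (\<forall>s\<in>T. \<forall>t\<in>T. (s, t) \<in> r \<longrightarrow> A s \<subseteq> A t)"

(* HOL cannot quantify existentially over the type underlying a measure space.  The next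
   lemma shows that asking for a family on the fixed type 'o set loses nothing: a family on
   any type has an image there (send x to the set of indices t with x in B t) with the same
   measures of all members and of the union. *)
lemma increasing_family_transfer:
  fixes T :: "'o set" and N :: "'b measure"
  assumes inc: "increasing_family T r N B" and un: "(\<Union>t\<in>T. B t) \<in> sets N"
  shows "\<exists>(E :: 'o set measure) C. increasing_family T r E C \<and> (\<Union>t\<in>T. C t) \<in> sets E \<and>
           (\<forall>t\<in>T. emeasure E (C t) = emeasure N (B t)) \<and>
           emeasure E (\<Union>t\<in>T. C t) = emeasure N (\<Union>t\<in>T. B t)"
proof -
  define f where "f x = {t\<in>T. x \<in> B t}" for x
  define S where "S = range f"
  define C where "C t = {U\<in>S. t \<in> U}" for t
  define G where "G = sigma S (insert (\<Union>t\<in>T. C t) (C ` T))"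
  define E where "E = distr N G f"
  have B: "B t \<in> sets N" if "t \<in> T" for t
    using inc that by (auto simp: increasing_family_def)
  have sp: "B t \<subseteq> space N" if "t \<in> T" for t
    using B[OF that] by (rule sets.sets_into_space)
  have pre: "f -` C t \<inter> space N = B t" if "t \<in> T" for t
    using sp[OF that] that by (auto simp: C_def f_def S_def)
  have preU: "f -` (\<Union>t\<in>T. C t) \<inter> space N = (\<Union>t\<in>T. B t)"
    using pre by (auto simp: vimage_UN)
  have sub: "insert (\<Union>t\<in>T. C t) (C ` T) \<subseteq> Pow S"
    by (auto simp: C_def)
  have f: "f \<in> measurable N G"
    unfolding G_def
  proof (rule measurable_measure_of[OF sub])
    show "f \<in> space N \<rightarrow> S" by (auto simp: S_def)
    fix Y assume "Y \<in> insert (\<Union>t\<in>T. C t) (C ` T)"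
    then show "f -` Y \<inter> space N \<in> sets N"
      using B un preU pre by auto
  qed
  have CG: "C t \<in> sets G" if "t \<in> T" for t
    using that sub by (auto simp: G_def)
  have UG: "(\<Union>t\<in>T. C t) \<in> sets G"
    using sub by (auto simp: G_def)
  have mono: "C s \<subseteq> C t" if "s \<in> T" "t \<in> T" "(s, t) \<in> r" for s t
    using inc that by (auto simp: increasing_family_def C_def S_def f_def)
  have "increasing_family T r E C"
    using CG mono by (auto simp: increasing_family_def E_def)
  moreover have "(\<Union>t\<in>T. C t) \<in> sets E"
    using UG by (simp add: E_def)
  moreover have "\<forall>t\<in>T. emeasure E (C t) = emeasure N (B t)"
    unfolding E_def using emeasure_distr[OF f CG] pre by auto
  moreover have "emeasure E (\<Union>t\<in>T. C t) = emeasure N (\<Union>t\<in>T. B t)"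
    unfolding E_def using emeasure_distr[OF f UG] preU by metis
  ultimately show ?thesis by blast
qed

end

theory Submission
  imports Defs
begin

text \<open>
  Let \<open>U\<close> be the union of the \<open>A t\<close>, and \<open>p > 0\<close> its probability. In the product of the given
  probability space with Lebesgue measure on the line, the rectangle \<open>U \<times> [0, M / p]\<close> has measure
  \<open>M\<close>. The rectangles \<open>U \<times> [0, m t / p]\<close> increase with \<open>t\<close> and have measure \<open>m t\<close>, but their
  union may be too small. Adjoining the null strips \<open>A t \<times> [0, M / p]\<close> repairs this: no measure
  changes and the family stays increasing, while the strips alone already exhaust
  \<open>U \<times> [0, M / p]\<close>. The family obtained lives on \<open>'a \<times> real\<close>, and
  \<open>increasing_family_transfer\<close> carries it over to \<open>'o set\<close>.
\<close>

text \<open>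
  Since the null sets \<open>A t\<close> together cover \<open>U\<close>, they can supply whatever mass the rectangles of
  height \<open>m t / p\<close> leave missing from \<open>M\<close>. Positivity and finiteness of \<open>p = P(U)\<close> allow heights
  to be rescaled by it.
\<close>

lemma increasing_family_with_prescribed_measures:
  fixes P :: "'a measure" and T :: "'o set" and A :: "'o \<Rightarrow> 'a set" and m :: "'o \<Rightarrow> real"
  defines "U \<equiv> (\<Union>t\<in>T. A t)"
  assumes inc: "increasing_family T r P A"
    and null: "\<And>t. t \<in> T \<Longrightarrow> emeasure P (A t) = 0"
    and U: "U \<in> sets P" "0 < emeasure P U" "emeasure P U < \<infinity>"
    and m: "\<And>t. t \<in> T \<Longrightarrow> 0 \<le> m t" "\<And>t. t \<in> T \<Longrightarrow> m t \<le> M"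
    and m_mono: "\<And>s t. s \<in> T \<Longrightarrow> t \<in> T \<Longrightarrow> (s, t) \<in> r \<Longrightarrow> m s \<le> m t"
  shows "\<exists>(N :: ('a \<times> real) measure) B.
          increasing_family T r N B \<and> (\<Union>t\<in>T. B t) \<in> sets N \<and>
          (\<forall>t\<in>T. emeasure N (B t) = ennreal (m t)) \<and>
          emeasure N (\<Union>t\<in>T. B t) = ennreal M"
proof -
  define p where "p = measure P U"
  have p: "emeasure P U = ennreal p" "0 < p"
    using U(2,3) by (simp_all add: p_def measure_def enn2real_positive_iff)
  have "T \<noteq> {}"
    using U(2) by (auto simp: U_def)
  then have M: "0 \<le> M"
    using m by (meson all_not_in_conv order_trans)
  define N where "N = P \<Otimes>\<^sub>M (lborel :: real measure)"
  define B where "B t = A t \<times> {0..M / p} \<union> U \<times> {0..m t / p}" for t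
  have A: "A t \<in> sets P" if "t \<in> T" for t
    using inc that by (auto simp: increasing_family_def)
  have rect: "emeasure N (U \<times> {0..x / p}) = ennreal x" if "0 \<le> x" for x
    using that p U(1)
    by (simp add: N_def lborel.emeasure_pair_measure_Times flip: ennreal_mult)
  have strip: "A t \<times> {0..M / p} \<in> null_sets N" if "t \<in> T" for t
    using A[OF that] null[OF that]
    by (intro null_setsI) (simp_all add: N_def lborel.emeasure_pair_measure_Times)
  have base: "U \<times> {0..x} \<in> sets N" for x
    using U(1) by (simp add: N_def)
  have union: "(\<Union>t\<in>T. B t) = U \<times> {0..M / p}"
  proof
    have "B t \<subseteq> U \<times> {0..M / p}" if "t \<in> T" for t
    proof -
      have "m t / p \<le> M / p"
        using m(2)[OF that] p(2) by (simp add: divide_right_mono)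
      moreover have "A t \<subseteq> U"
        using that by (auto simp: U_def)
      ultimately show ?thesis
        unfolding B_def by (intro Un_least Sigma_mono) simp_all
    qed
    then show "(\<Union>t\<in>T. B t) \<subseteq> U \<times> {0..M / p}"
      by blast
    show "U \<times> {0..M / p} \<subseteq> (\<Union>t\<in>T. B t)"
      unfolding B_def U_def by blast
  qed
  have "B s \<subseteq> B t" if "s \<in> T" "t \<in> T" "(s, t) \<in> r" for s t
  proof -
    have "A s \<subseteq> A t"
      using inc that by (auto simp: increasing_family_def)
    moreover have "m s / p \<le> m t / p"
      using m_mono[OF that] p(2) by (simp add: divide_right_mono)
    ultimately show ?thesis
      unfolding B_def by (intro Un_mono Sigma_mono) simp_all
  qed
  moreover have "B t \<in> sets N" if "t \<in> T" for t
    using strip[OF that] base by (auto simp: B_def)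
  ultimately have "increasing_family T r N B"
    by (simp add: increasing_family_def)
  moreover have "\<forall>t\<in>T. emeasure N (B t) = ennreal (m t)"
    using strip base rect m(1) by (simp add: B_def Un_commute[of "A _ \<times> _"] emeasure_Un_null_set)
  moreover have "(\<Union>t\<in>T. B t) \<in> sets N" "emeasure N (\<Union>t\<in>T. B t) = ennreal M"
    unfolding union using base rect[OF M] by blast+
  ultimately show ?thesis
    by blast
qed

theorem corollary4:
  fixes T :: "'o set" and r :: "('o \<times> 'o) set"
    and m :: "'o \<Rightarrow> real" and M :: real
  assumes order: "linear_order_on T r"
    and source: "\<exists>(P :: 'a measure) A.
          prob_space P \<and> increasing_family T r P A \<and> (\<Union>t\<in>T. A t) \<in> sets P \<and>
          emeasure P (\<Union>t\<in>T. A t) > (SUP t\<in>T. emeasure P (A t)) \<and>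
          (SUP t\<in>T. emeasure P (A t)) = 0"
    and m_nonneg: "\<And>t. t \<in> T \<Longrightarrow> 0 \<le> m t"
    and m_mono: "\<And>s t. s \<in> T \<Longrightarrow> t \<in> T \<Longrightarrow> (s, t) \<in> r \<Longrightarrow> m s \<le> m t"
    and M_ge: "ereal M \<ge> (SUP t\<in>T. ereal (m t))"
  shows "\<exists>(E :: 'o set measure) B.
          increasing_family T r E B \<and> (\<Union>t\<in>T. B t) \<in> sets E \<and>
          (\<forall>t\<in>T. emeasure E (B t) = ennreal (m t)) \<and>
          emeasure E (\<Union>t\<in>T. B t) = ennreal M"
proof -
  obtain P :: "'a measure" and A
    where P: "prob_space P" and inc: "increasing_family T r P A" and U: "(\<Union>t\<in>T. A t) \<in> sets P"
      and pos: "emeasure P (\<Union>t\<in>T. A t) > (SUP t\<in>T. emeasure P (A t))"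
      and sup0: "(SUP t\<in>T. emeasure P (A t)) = 0"
    using source by blast
  interpret prob_space P by (rule P)
  have null: "emeasure P (A t) = 0" if "t \<in> T" for t
    using SUP_upper[OF that, of "\<lambda>t. emeasure P (A t)"] sup0 by simp
  have le: "m t \<le> M" if "t \<in> T" for t
    using order_trans[OF SUP_upper[OF that, of "\<lambda>t. ereal (m t)"] M_ge] by simp
  have fin: "emeasure P (\<Union>t\<in>T. A t) < \<infinity>"
    by (simp add: less_top[symmetric])
  obtain N :: "('a \<times> real) measure" and B
    where N: "increasing_family T r N B" "(\<Union>t\<in>T. B t) \<in> sets N"
      "\<forall>t\<in>T. emeasure N (B t) = ennreal (m t)" "emeasure N (\<Union>t\<in>T. B t) = ennreal M"
    using increasing_family_with_prescribed_measures
        [where m = m, OF inc null U pos[unfolded sup0] fin m_nonneg le m_mono]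
    by blast
  show ?thesis
    using increasing_family_transfer[OF N(1,2)] N(3,4) by auto
qed

end
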